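(* Let $G$ be a graph, let $l\ge 0$ be an integer, and let $H=ILT_l(G)$. If $U\subseteq V(G)$ is a zero forcing set of $G$, then the set consisting of $U$ together with all descendants in $H$ of vertices of $U$ is a zero forcing set of $H$. Consequently, $Z(H)\le 2^l Z(G)$.
   Context: Graphs are finite, simple, undirected and have at least one vertex. For a vertex $v$ of a graph $G$, $N(v)$ is its neighborhood and $N[v]=N(v)\cup\{v\}$. A new vertex $v'$ added to $G$ is a clone of $v\in V(G)$ if $N(v')=N[v]$. The ILT graphs with base graph $G$ are defined by $ILT_0(G)=G$; $ILT_1(G)$ is the graph obtained from $G$ by simultaneously adding exactly one clone of every vertex of $G$ (the new vertices are pairwise non-adjacent); and $ILT_l(G)=ILT_1(ILT_{l-1}(G))$. Thus $G$ is an induced subgraph of $ILT_l(G)$. A vertex $u$ of $ILT_l(G)$ is a descendant of a vertex $v$ if $u$ is obtained from $v$ by successive cloning, i.e. there is a sequence $v=w_0,w_1,\dots,w_k=u$ with $k\ge 1$ in which each $w_{i+1}$ was added as a clone of $w_i$ at some time step. Zero forcing on a graph $G$: start with a set $S\subseteq V(G)$ of forced vertices, the remaining vertices being unforced. At each time step, any forced vertex with exactly one unforced neighbor $u$ causes $u$ to become forced. $S$ is a zero forcing set if by iterating this process every vertex eventually becomes forced. $Z(G)$, the zero forcing number, is the minimum cardinality of a zero forcing set of $G$. *)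

theory Defs
  imports "Graph_Theory.Pair_Digraph"
begin

text \<open>
  A finite simple undirected graph is a \<open>pair_graph\<close>: a finite, loop-free digraph without
  parallel arcs whose arc relation is symmetric, so an edge is a pair of opposite arcs.
\<close>

definition nbhd :: "'a pair_pre_digraph \<Rightarrow> 'a \<Rightarrow> 'a set" where
  "nbhd G v = {w. (v, w) \<in> parcs G}"

definition closed_nbhd :: "'a pair_pre_digraph \<Rightarrow> 'a \<Rightarrow> 'a set" where
  "closed_nbhd G v = insert v (nbhd G v)"


section \<open>ILT graphs\<close>

text \<open>
  \<open>Clone t w\<close> is the clone of \<open>w\<close> added in the step from the \<open>t\<close>-th to the \<open>(t+1)\<close>-st ILT graph.
  The time stamp makes every clone a fresh vertex, so that each ILT graph literally contains the
  previous one.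
\<close>

datatype 'a ilt_vertex = Base 'a | Clone nat "'a ilt_vertex"

definition base_graph :: "'a pair_pre_digraph \<Rightarrow> 'a ilt_vertex pair_pre_digraph" where
  "base_graph G = \<lparr> pverts = Base ` pverts G, parcs = map_prod Base Base ` parcs G \<rparr>"

definition ilt_step :: "nat \<Rightarrow> 'a ilt_vertex pair_pre_digraph \<Rightarrow> 'a ilt_vertex pair_pre_digraph" where
  "ilt_step t G =
    \<lparr> pverts = pverts G \<union> Clone t ` pverts G,
      parcs = parcs G
        \<union> {(Clone t v, w) | v w. v \<in> pverts G \<and> w \<in> closed_nbhd G v}
        \<union> {(w, Clone t v) | v w. v \<in> pverts G \<and> w \<in> closed_nbhd G v} \<rparr>"

primrec ILT :: "nat \<Rightarrow> 'a pair_pre_digraph \<Rightarrow> 'a ilt_vertex pair_pre_digraph" where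
  "ILT 0 G = base_graph G"
| "ILT (Suc l) G = ilt_step l (ILT l G)"

definition added_as_clone :: "'a pair_pre_digraph \<Rightarrow> nat \<Rightarrow> 'a ilt_vertex \<Rightarrow> 'a ilt_vertex \<Rightarrow> bool" where
  "added_as_clone G l w w' \<longleftrightarrow> (\<exists>t<l. w \<in> pverts (ILT t G) \<and> w' = Clone t w)"

text \<open>\<open>descendant G l v u\<close>: in the \<open>l\<close>-th ILT graph over \<open>G\<close>, the vertex \<open>u\<close> is a descendant of \<open>v\<close>.\<close>

definition descendant :: "'a pair_pre_digraph \<Rightarrow> nat \<Rightarrow> 'a ilt_vertex \<Rightarrow> 'a ilt_vertex \<Rightarrow> bool" where
  "descendant G l = (added_as_clone G l)\<^sup>+\<^sup>+"


section \<open>Zero forcing\<close>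

definition zf_step :: "'a pair_pre_digraph \<Rightarrow> 'a set \<Rightarrow> 'a set" where
  "zf_step G S = S \<union> {u. \<exists>v\<in>S. nbhd G v - S = {u}}"

definition zero_forcing_set :: "'a pair_pre_digraph \<Rightarrow> 'a set \<Rightarrow> bool" where
  "zero_forcing_set G S \<longleftrightarrow> S \<subseteq> pverts G \<and> (\<exists>n. (zf_step G ^^ n) S = pverts G)"

text \<open>For finite \<open>G\<close> the minimum is over a finite set containing \<open>card (pverts G)\<close>.\<close>

definition zero_forcing_number :: "'a pair_pre_digraph \<Rightarrow> nat" where
  "zero_forcing_number G = Min (card ` {S. zero_forcing_set G S})"


section \<open>The ILT construction agrees with its description by clones\<close>

lemma Clone_in_ILT: "Clone t w \<in> pverts (ILT l G) \<Longrightarrow> t < l"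
  by (induction l) (auto simp: base_graph_def ilt_step_def less_Suc_eq)

lemma pair_graph_base_graph:
  assumes "pair_graph G"
  shows "pair_graph (base_graph G)"
proof -
  interpret pair_graph G by (rule assms)
  have "sym (parcs G)"
    using pair_sym_arcs by (simp add: symmetric_def)
  then show ?thesis
    using pair_finite_verts pair_finite_arcs
    by unfold_locales
      (auto simp: base_graph_def symmetric_def sym_def in_arcsD1 in_arcsD2 dest: pair_no_loops)
qed

lemma pair_graph_ilt_step:
  assumes "pair_graph G" and fresh: "\<And>v. Clone t v \<notin> pverts G"
  shows "pair_graph (ilt_step t G)"
proof -
  interpret pair_graph G by (rule assms)
  have sym: "sym (parcs G)"
    using pair_sym_arcs by (simp add: symmetric_def)
  have nb: "closed_nbhd G v \<subseteq> pverts G" if "v \<in> pverts G" for v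
    using that by (auto simp: closed_nbhd_def nbhd_def in_arcsD2)
  have fin: "finite (pverts (ilt_step t G))"
    by (simp add: ilt_step_def pair_finite_verts)
  have sub: "parcs (ilt_step t G) \<subseteq> pverts (ilt_step t G) \<times> pverts (ilt_step t G)"
    using nb by (auto simp: ilt_step_def in_arcsD1 in_arcsD2)
  have fresh_nb: "Clone t v \<notin> closed_nbhd G v" if "v \<in> pverts G" for v
    using nb[OF that] fresh by blast
  have loop: "fst e \<noteq> snd e" if "e \<in> parcs (ilt_step t G)" for e
    using that fresh_nb by (auto simp: ilt_step_def dest: pair_no_loops)
  have "sym (parcs (ilt_step t G))"
    using sym by (auto simp: ilt_step_def sym_def)
  moreover have "finite (parcs (ilt_step t G))"
    using finite_subset[OF sub] fin by simp
  ultimately show ?thesis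
    using fin sub loop by unfold_locales (auto simp: symmetric_def)
qed

lemma pair_graph_ILT: "pair_graph G \<Longrightarrow> pair_graph (ILT l G)"
  by (induction l) (auto intro: pair_graph_base_graph pair_graph_ilt_step dest: Clone_in_ILT)

lemma nbhd_Clone_ILT:
  assumes "pair_graph G" "v \<in> pverts (ILT l G)"
  shows "nbhd (ILT (Suc l) G) (Clone l v) = closed_nbhd (ILT l G) v"
proof -
  interpret H: pair_graph "ILT l G" by (rule pair_graph_ILT[OF assms(1)])
  have "closed_nbhd (ILT l G) w \<subseteq> pverts (ILT l G)" if "w \<in> pverts (ILT l G)" for w
    using that by (auto simp: closed_nbhd_def nbhd_def H.in_arcsD2)
  moreover have "Clone l w \<notin> pverts (ILT l G)" for w
    using Clone_in_ILT[of l w l G] by auto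
  ultimately show ?thesis
    using assms(2) by (auto simp: nbhd_def ilt_step_def dest: H.in_arcsD1 H.in_arcsD2)
qed

lemma ILT_induced:
  assumes "pair_graph G"
  shows "parcs (ILT (Suc l) G) \<inter> pverts (ILT l G) \<times> pverts (ILT l G) = parcs (ILT l G)"
proof -
  interpret H: pair_graph "ILT l G" by (rule pair_graph_ILT[OF assms])
  have "Clone l w \<notin> pverts (ILT l G)" for w
    using Clone_in_ILT[of l w l G] by auto
  then show ?thesis
    by (auto simp: ilt_step_def dest: H.in_arcsD1 H.in_arcsD2)
qed

end

theory Submission
  imports Defs
begin

text \<open>
  One cloning step already shows why the theorem holds. Suppose that in \<open>G\<close> the vertex \<open>v\<close> forces
  \<open>u\<close> while the forced set is \<open>S\<close>. In the cloned graph, let \<open>S\<close> and the clones of \<open>S\<close> be forced.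
  The clone \<open>v'\<close> sees exactly \<open>N[v]\<close>, so \<open>u\<close> is its only unforced neighbour and \<open>v'\<close> forces \<open>u\<close>.
  After that, the neighbours of \<open>v\<close> are \<open>N(v)\<close>, now entirely forced, and the clones of \<open>N[v]\<close>, of
  which only \<open>u'\<close> is unforced, so \<open>v\<close> forces \<open>u'\<close>. Hence one round of forcing in \<open>G\<close> is matched by
  two rounds in the cloned graph (\<open>double_zf_step\<close>), and doubling a zero forcing set gives a zero
  forcing set (\<open>zero_forcing_set_ilt_step\<close>).

  To iterate this, call the base vertex from which a vertex is obtained by cloning its origin. The
  vertices of \<open>U\<close> and their descendants are the vertices with origin in \<open>U\<close>
  (\<open>descendants_eq_origin_in\<close>), and these vertices double in each step. The first claim follows by
  induction on \<open>l\<close>, and counting gives at most \<open>2 ^ l * card U\<close> vertices, hence the second.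
\<close>

section \<open>Zero forcing is monotone\<close>

lemma zf_step_extensive: "S \<subseteq> zf_step G S"
  by (auto simp: zf_step_def)

text \<open>
  Forcing more vertices early cannot hurt: the only unforced neighbour of a forced vertex either
  remains the only one or has been forced already.
\<close>

lemma zf_step_mono:
  assumes "S \<subseteq> T"
  shows "zf_step G S \<subseteq> zf_step G T"
proof
  fix u assume "u \<in> zf_step G S"
  then consider "u \<in> S" | v where "v \<in> S" "nbhd G v - S = {u}"
    by (auto simp: zf_step_def)
  then show "u \<in> zf_step G T"
  proof cases
    case 1
    then show ?thesis using assms by (auto simp: zf_step_def)
  next
    case 2
    then have "nbhd G v - T = {u} \<or> u \<in> T" "v \<in> T" using assms by blast+
    then show ?thesis by (auto simp: zf_step_def)
  qed
qed

lemma (in pair_graph) nbhd_subset: "nbhd G v \<subseteq> pverts G"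
  by (auto simp: nbhd_def in_arcsD2)

lemma (in pair_graph) nbhd_sym: "w \<in> nbhd G v \<longleftrightarrow> v \<in> nbhd G w"
  using pair_sym_arcs by (auto simp: nbhd_def symmetric_def dest: symD)

lemma (in pair_graph) zf_step_subset:
  assumes "S \<subseteq> pverts G"
  shows "zf_step G S \<subseteq> pverts G"
  using assms nbhd_subset by (fastforce simp: zf_step_def)

lemma (in pair_graph) zf_iter_subset:
  assumes "S \<subseteq> pverts G"
  shows "(zf_step G ^^ n) S \<subseteq> pverts G"
  by (induction n) (simp_all add: assms zf_step_subset)

lemma (in pair_graph) zero_forcing_setI:
  assumes "S \<subseteq> pverts G" "pverts G \<subseteq> (zf_step G ^^ n) S"
  shows "zero_forcing_set G S"
  using assms zf_iter_subset[of S n] unfolding zero_forcing_set_def by blast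

section \<open>One cloning step\<close>

lemma (in pair_graph) zero_forcing_set_base_graph:
  assumes "zero_forcing_set G U"
  shows "zero_forcing_set (base_graph G) (Base ` U)"
proof -
  have nb: "nbhd (base_graph G) (Base v) = Base ` nbhd G v" for v
    by (force simp: nbhd_def base_graph_def)
  have step: "zf_step (base_graph G) (Base ` S) = Base ` zf_step G S" for S
  proof -
    have "Base ` nbhd G v - Base ` S = {x} \<longleftrightarrow> (\<exists>u. x = Base u \<and> nbhd G v - S = {u})" for v x
    proof -
      have "Base ` nbhd G v - Base ` S = Base ` (nbhd G v - S)" by auto
      moreover have "Base ` X = {x} \<longleftrightarrow> (\<exists>u. x = Base u \<and> X = {u})" for X
        by (auto simp: set_eq_iff image_iff) (metis ilt_vertex.inject(1))+
      ultimately show ?thesis by simp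
    qed
    then show ?thesis by (auto simp: zf_step_def nb)
  qed
  have iter: "(zf_step (base_graph G) ^^ n) (Base ` U) = Base ` (zf_step G ^^ n) U" for n
    by (induction n) (simp_all add: step)
  obtain n where "U \<subseteq> pverts G" "(zf_step G ^^ n) U = pverts G"
    using assms by (auto simp: zero_forcing_set_def)
  moreover have "pverts (base_graph G) = Base ` pverts G" by (simp add: base_graph_def)
  ultimately show ?thesis
    unfolding zero_forcing_set_def using iter[of n] by (intro conjI exI[of _ n]) auto
qed

definition with_clones :: "nat \<Rightarrow> 'a ilt_vertex set \<Rightarrow> 'a ilt_vertex set" where
  "with_clones t S = S \<union> Clone t ` S"

lemma with_clones_mono: "S \<subseteq> T \<Longrightarrow> with_clones t S \<subseteq> with_clones t T"
  by (auto simp: with_clones_def)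

lemma pverts_ilt_step: "pverts (ilt_step t H) = with_clones t (pverts H)"
  by (simp add: ilt_step_def with_clones_def)

context
  fixes H :: "'a ilt_vertex pair_pre_digraph" and t :: nat
  assumes H: "pair_graph H" and fresh: "\<And>v. Clone t v \<notin> pverts H"
begin

interpretation H: pair_graph H by (rule H)

lemma nbhd_ilt_step_Clone:
  assumes "v \<in> pverts H"
  shows "nbhd (ilt_step t H) (Clone t v) = closed_nbhd H v"
proof -
  have "closed_nbhd H w \<subseteq> pverts H" if "w \<in> pverts H" for w
    using that H.nbhd_subset by (auto simp: closed_nbhd_def)
  then show ?thesis
    using assms fresh by (auto simp: nbhd_def ilt_step_def dest: H.in_arcsD1)
qed

lemma nbhd_ilt_step_old:
  assumes "v \<in> pverts H"
  shows "nbhd (ilt_step t H) v = nbhd H v \<union> Clone t ` closed_nbhd H v"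
proof -
  have "{w \<in> pverts H. v \<in> closed_nbhd H w} = closed_nbhd H v"
    using assms H.nbhd_sym H.nbhd_subset by (auto simp: closed_nbhd_def)
  moreover have "nbhd (ilt_step t H) v = nbhd H v \<union> Clone t ` {w \<in> pverts H. v \<in> closed_nbhd H w}"
    using assms fresh by (auto simp: nbhd_def ilt_step_def)
  ultimately show ?thesis by simp
qed

text \<open>
  If \<open>v\<close> forces \<open>u\<close> before cloning, then afterwards the clone of \<open>v\<close> forces \<open>u\<close> in the first round
  and \<open>v\<close> forces the clone of \<open>u\<close> in the second.
\<close>

lemma double_zf_step:
  assumes S: "S \<subseteq> pverts H"
  shows "with_clones t (zf_step H S)
         \<subseteq> zf_step (ilt_step t H) (zf_step (ilt_step t H) (with_clones t S))"
proof -
  \<comment> \<open>The first round may force more vertices than \<open>A\<close>, which does no harm by monotonicity.\<close>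
  define A where "A = zf_step H S \<union> Clone t ` S"
  have clone_in_iff: "Clone t x \<in> zf_step H S \<union> Clone t ` X \<longleftrightarrow> x \<in> X" for x X
    using fresh H.zf_step_subset[OF S] by auto
  have first: "A \<subseteq> zf_step (ilt_step t H) (with_clones t S)"
  proof -
    have "u \<in> zf_step (ilt_step t H) (with_clones t S)"
      if v: "v \<in> S" and u: "nbhd H v - S = {u}" for u v
    proof -
      have "u \<in> pverts H" using u H.nbhd_subset by blast
      then have "u \<notin> Clone t ` S" using fresh by blast
      then have "closed_nbhd H v - with_clones t S = {u}"
        using v u by (auto simp: closed_nbhd_def with_clones_def)
      then have "nbhd (ilt_step t H) (Clone t v) - with_clones t S = {u}"
        using nbhd_ilt_step_Clone v S by auto
      moreover have "Clone t v \<in> with_clones t S" using v by (simp add: with_clones_def)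
      ultimately show ?thesis unfolding zf_step_def by blast
    qed
    moreover have "with_clones t S \<subseteq> zf_step (ilt_step t H) (with_clones t S)"
      by (rule zf_step_extensive)
    ultimately show ?thesis
      unfolding A_def by (auto simp: zf_step_def[of H] with_clones_def)
  qed
  have second: "with_clones t (zf_step H S) \<subseteq> zf_step (ilt_step t H) A"
  proof -
    have "Clone t u \<in> zf_step (ilt_step t H) A"
      if v: "v \<in> S" and u: "nbhd H v - S = {u}" for u v
    proof -
      have "u \<in> zf_step H S" using u v unfolding zf_step_def by blast
      moreover have "nbhd H v \<subseteq> insert u S" using u by auto
      ultimately have "nbhd H v \<subseteq> A" using zf_step_extensive[of S H] unfolding A_def by blast
      moreover have "Clone t ` closed_nbhd H v - A = Clone t ` (closed_nbhd H v - S)"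
        using clone_in_iff[of _ S] unfolding A_def by blast
      moreover have "closed_nbhd H v - S = {u}"
        using v u by (auto simp: closed_nbhd_def)
      moreover have "nbhd (ilt_step t H) v = nbhd H v \<union> Clone t ` closed_nbhd H v"
        using nbhd_ilt_step_old v S by blast
      ultimately have "nbhd (ilt_step t H) v - A = {Clone t u}"
        by auto
      moreover have "v \<in> A" using v by (auto simp: A_def zf_step_def)
      ultimately show ?thesis unfolding zf_step_def by blast
    qed
    moreover have "A \<subseteq> zf_step (ilt_step t H) A"
      by (rule zf_step_extensive)
    moreover have "zf_step H S \<subseteq> A" "Clone t ` S \<subseteq> A" by (auto simp: A_def)
    ultimately have "zf_step H S \<subseteq> zf_step (ilt_step t H) A"
      and "Clone t x \<in> zf_step (ilt_step t H) A" if "x \<in> zf_step H S" for x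
      using that unfolding zf_step_def[of H] by blast+
    then show ?thesis
      unfolding with_clones_def by blast
  qed
  show ?thesis
    using second zf_step_mono[OF first] by (rule subset_trans)
qed

lemma zero_forcing_set_ilt_step:
  assumes "zero_forcing_set H S"
  shows "zero_forcing_set (ilt_step t H) (with_clones t S)"
proof -
  interpret H': pair_graph "ilt_step t H"
    by (rule pair_graph_ilt_step[OF H fresh])
  obtain n where S: "S \<subseteq> pverts H" and n: "(zf_step H ^^ n) S = pverts H"
    using assms by (auto simp: zero_forcing_set_def)
  have "with_clones t ((zf_step H ^^ k) S) \<subseteq> (zf_step (ilt_step t H) ^^ (2 * k)) (with_clones t S)"
    for k
  proof (induction k)
    case 0
    show ?case by simp
  next
    case (Suc k)
    have "with_clones t ((zf_step H ^^ Suc k) S)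
        \<subseteq> zf_step (ilt_step t H) (zf_step (ilt_step t H) (with_clones t ((zf_step H ^^ k) S)))"
      using double_zf_step[OF H.zf_iter_subset[OF S]] by simp
    also have "\<dots> \<subseteq> zf_step (ilt_step t H) (zf_step (ilt_step t H)
        ((zf_step (ilt_step t H) ^^ (2 * k)) (with_clones t S)))"
      by (intro zf_step_mono Suc.IH)
    finally show ?case by simp
  qed
  from this[of n] show ?thesis
    using S by (intro H'.zero_forcing_setI[of _ "2 * n"])
      (simp_all add: n pverts_ilt_step with_clones_mono)
qed

end

section \<open>Descendants\<close>

primrec origin :: "'a ilt_vertex \<Rightarrow> 'a" where
  "origin (Base v) = v"
| "origin (Clone t w) = origin w"

lemma origin_descendant:
  assumes "descendant G l v u"
  shows "origin u = origin v"
  using assms unfolding descendant_def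
  by (induction rule: tranclp_induct) (auto simp: added_as_clone_def)

lemma descendant_mono:
  assumes "descendant G l v u" "l \<le> m"
  shows "descendant G m v u"
proof -
  have step: "added_as_clone G m x y" if "added_as_clone G l x y" for x y
    using that assms(2) by (force simp: added_as_clone_def)
  show ?thesis
    using assms(1) unfolding descendant_def
    by (induction rule: tranclp_induct) (metis step tranclp.intros)+
qed

lemma Base_in_ILT: "v \<in> pverts G \<Longrightarrow> Base v \<in> pverts (ILT l G)"
  by (induction l) (auto simp: base_graph_def ilt_step_def)

text \<open>
  Undo the cloning steps, the latest one first. A base vertex is no descendant of itself, since a
  descendant is reached by at least one cloning; hence the first alternative.
\<close>

lemma descendant_of_origin:
  assumes "u \<in> pverts (ILT l G)"
  shows "u = Base (origin u) \<or> descendant G l (Base (origin u)) u"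
  using assms
proof (induction l arbitrary: u)
  case 0
  then show ?case by (auto simp: base_graph_def)
next
  case (Suc l)
  show ?case
  proof (cases "u \<in> pverts (ILT l G)")
    case True
    then show ?thesis using Suc.IH descendant_mono[of G l _ u "Suc l"] by auto
  next
    case False
    then obtain w where w: "w \<in> pverts (ILT l G)" and u: "u = Clone l w"
      using Suc.prems by (auto simp: ilt_step_def)
    have step: "added_as_clone G (Suc l) w u"
      using w u by (auto simp: added_as_clone_def)
    from Suc.IH[OF w] have "descendant G (Suc l) (Base (origin w)) u"
    proof
      assume "w = Base (origin w)"
      then show ?thesis using step unfolding descendant_def by (metis tranclp.r_into_trancl)
    next
      assume "descendant G l (Base (origin w)) w"
      then have "descendant G (Suc l) (Base (origin w)) w" by (rule descendant_mono) simp
      then show ?thesis using step unfolding descendant_def by (rule tranclp.trancl_into_trancl)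
    qed
    then show ?thesis using u by simp
  qed
qed

definition origin_in :: "'a pair_pre_digraph \<Rightarrow> nat \<Rightarrow> 'a set \<Rightarrow> 'a ilt_vertex set" where
  "origin_in G l U = {u \<in> pverts (ILT l G). origin u \<in> U}"

text \<open>
  This replaces the transitive closure by a condition on single vertices, for which passing from
  \<open>l\<close> to \<open>l + 1\<close> just adds the clones (\<open>origin_in_Suc\<close>).
\<close>

lemma descendants_eq_origin_in:
  assumes "U \<subseteq> pverts G"
  shows "Base ` U \<union> {u \<in> pverts (ILT l G). \<exists>v\<in>U. descendant G l (Base v) u} = origin_in G l U"
    (is "?D = _")
proof
  show "?D \<subseteq> origin_in G l U"
    using assms by (auto simp: origin_in_def Base_in_ILT dest: origin_descendant)
  show "origin_in G l U \<subseteq> ?D"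
    using descendant_of_origin by (fastforce simp: origin_in_def)
qed

lemma origin_in_0:
  assumes "U \<subseteq> pverts G"
  shows "origin_in G 0 U = Base ` U"
  using assms by (auto simp: origin_in_def base_graph_def)

lemma origin_in_Suc: "origin_in G (Suc l) U = with_clones l (origin_in G l U)"
  by (auto simp: origin_in_def pverts_ilt_step with_clones_def)

section \<open>Zero forcing in ILT graphs\<close>

lemma zero_forcing_set_origin_in:
  assumes "pair_graph G" "zero_forcing_set G U"
  shows "zero_forcing_set (ILT l G) (origin_in G l U)"
proof (induction l)
  case 0
  have "U \<subseteq> pverts G" using assms(2) by (simp add: zero_forcing_set_def)
  then show ?case
    using pair_graph.zero_forcing_set_base_graph[OF assms] by (simp add: origin_in_0)
next
  case (Suc l)
  have "Clone l v \<notin> pverts (ILT l G)" for v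
    using Clone_in_ILT[of l v l G] by auto
  then show ?case
    using zero_forcing_set_ilt_step[OF pair_graph_ILT[OF assms(1)] _ Suc.IH]
    by (simp add: origin_in_Suc)
qed

lemma card_origin_in:
  assumes "finite U" "U \<subseteq> pverts G"
  shows "card (origin_in G l U) \<le> 2 ^ l * card U"
proof (induction l)
  case 0
  then show ?case using assms by (simp add: origin_in_0 card_image_le)
next
  case (Suc l)
  have fin: "finite (origin_in G l U)"
    by (induction l) (use assms in \<open>simp_all add: origin_in_0 origin_in_Suc with_clones_def\<close>)
  have "card (with_clones l (origin_in G l U))
      \<le> card (origin_in G l U) + card (Clone l ` origin_in G l U)"
    unfolding with_clones_def by (rule card_Un_le)
  also have "\<dots> \<le> 2 * card (origin_in G l U)"
    using card_image_le[OF fin, of "Clone l"] by simp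
  finally show ?case using Suc.IH by (simp add: origin_in_Suc)
qed

lemma (in pair_graph) finite_zero_forcing_sets: "finite {S. zero_forcing_set G S}"
  by (rule finite_subset[of _ "Pow (pverts G)"])
    (auto simp: zero_forcing_set_def pair_finite_verts)

lemma (in pair_graph) zero_forcing_number_le:
  assumes "zero_forcing_set G S"
  shows "zero_forcing_number G \<le> card S"
  using assms finite_zero_forcing_sets by (simp add: zero_forcing_number_def)

lemma (in pair_graph) zero_forcing_number_attained:
  obtains S where "zero_forcing_set G S" "card S = zero_forcing_number G"
proof -
  have "zero_forcing_set G (pverts G)"
    by (rule zero_forcing_setI[of _ 0]) simp_all
  then have "zero_forcing_number G \<in> card ` {S. zero_forcing_set G S}"
    unfolding zero_forcing_number_def
    by (intro Min_in finite_imageI finite_zero_forcing_sets) auto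
  then show thesis using that by auto
qed

theorem theorem4p1:
  fixes G :: "'a pair_pre_digraph" and l :: nat
  assumes "pair_graph G" and "pverts G \<noteq> {}"
  shows "(\<forall>U. U \<subseteq> pverts G \<and> zero_forcing_set G U \<longrightarrow>
            zero_forcing_set (ILT l G)
              (Base ` U \<union> {u \<in> pverts (ILT l G). \<exists>v\<in>U. descendant G l (Base v) u}))
         \<and> zero_forcing_number (ILT l G) \<le> 2 ^ l * zero_forcing_number G"
proof -
  interpret pair_graph G by (rule assms(1))
  have sets: "\<forall>U. U \<subseteq> pverts G \<and> zero_forcing_set G U \<longrightarrow>
            zero_forcing_set (ILT l G)
              (Base ` U \<union> {u \<in> pverts (ILT l G). \<exists>v\<in>U. descendant G l (Base v) u})"
    using zero_forcing_set_origin_in[OF assms(1)] by (simp add: descendants_eq_origin_in)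
  obtain U where U: "zero_forcing_set G U" "card U = zero_forcing_number G"
    by (rule zero_forcing_number_attained)
  have "U \<subseteq> pverts G" "finite U"
    using U(1) finite_subset[OF _ pair_finite_verts] by (auto simp: zero_forcing_set_def)
  then have "zero_forcing_number (ILT l G) \<le> 2 ^ l * zero_forcing_number G"
    using pair_graph.zero_forcing_number_le[OF pair_graph_ILT[OF assms(1)]
        zero_forcing_set_origin_in[OF assms(1) U(1)], of l]
      card_origin_in[of U G l] U(2) by simp
  with sets show ?thesis by blast
qed

end
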